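(* Let $\varphi$ be a polyhedral Finsler norm in $\mathbb{R}^d$. Then $\varphi$ has a shielding norm $\psi$. Moreover, for each $\delta>0$ there is a shielding norm $\psi_\delta$ for $\varphi$ such that $$\sup\{|\psi_\delta(e)-\varphi(e)|\,:\,e\in S^{d-1}\}\le\delta.$$
   Context: $\mathcal{S}^d$ is the space of real symmetric $d\times d$ matrices; $\langle\cdot,\cdot\rangle$ and $\|\cdot\|$ are the Euclidean inner product and norm; $S^{d-1}$ is the Euclidean unit sphere. A Finsler norm is a function $\varphi:\mathbb{R}^d\to[0,\infty)$ with $\varphi(\lambda q)=\lambda\varphi(q)$ for $\lambda>0$, $\varphi(q_1+q_2)\le\varphi(q_1)+\varphi(q_2)$, and $\min_{q\neq0}\varphi(q)/\|q\|>0$ (symmetry is not required). It is polyhedral if there is a finite set $\{p_1,\dots,p_N\}\subseteq\mathbb{R}^d\setminus\{0\}$ with $\varphi(q)=\max\{\langle p_1,q\rangle,\dots,\langle p_N,q\rangle\}$ for all $q$. The dual norm is $\varphi^*(p)=\max_{q\ne0}\langle p,q\rangle/\varphi(q)$, and $\partial\varphi^*(p)$ is the usual convex subdifferential of $\varphi^*$ at $p$. For $p\in\mathbb{R}^d$ let $\mathcal{T}(p,\varphi)=\{v\in\mathbb{R}^d:\langle v,q\rangle=0\ \text{for all}\ q\in\partial\varphi^*(p)\}$. For a linear subspace $V\subseteq\mathbb{R}^d$ let $\pi_V$ be the orthogonal projection onto $V$ and $\mathcal{S}_V=\{X\in\mathcal{S}^d:\pi_V X\pi_V=X\}$. Set $\mathcal{S}(p,\varphi)=\mathcal{S}_{\langle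 p\rangle\oplus\mathcal{T}(p,\varphi)}$, where $\langle p\rangle$ is the linear span of $p$. A Finsler norm $\psi$ is a shielding norm for $\varphi$ if $\psi\in C^2(\mathbb{R}^d\setminus\{0\})$ and $D^2\psi(q)\in\mathcal{S}(D\psi(q),\varphi)$ for every $q\in\mathbb{R}^d\setminus\{0\}$. *)

theory Defs
  imports "HOL-Analysis.Analysis"
begin

definition finsler_norm :: "(real^'n \<Rightarrow> real) \<Rightarrow> bool" where
  "finsler_norm \<phi> \<longleftrightarrow>
     (\<forall>q. 0 \<le> \<phi> q) \<and>
     (\<forall>q. \<forall>t>0. \<phi> (t *\<^sub>R q) = t * \<phi> q) \<and>
     (\<forall>q1 q2. \<phi> (q1 + q2) \<le> \<phi> q1 + \<phi> q2) \<and>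
     (\<exists>q0. q0 \<noteq> 0 \<and> (\<forall>q. q \<noteq> 0 \<longrightarrow> \<phi> q0 / norm q0 \<le> \<phi> q / norm q) \<and> 0 < \<phi> q0 / norm q0)"

definition polyhedral :: "(real^'n \<Rightarrow> real) \<Rightarrow> bool" where
  "polyhedral \<phi> \<longleftrightarrow>
     (\<exists>P. finite P \<and> P \<noteq> {} \<and> 0 \<notin> P \<and> (\<forall>q. \<phi> q = Max ((\<lambda>p. p \<bullet> q) ` P)))"

(* For a Finsler norm this supremum is a maximum, see dual_norm_attained below. *)
definition dual_norm :: "(real^'n \<Rightarrow> real) \<Rightarrow> real^'n \<Rightarrow> real" where
  "dual_norm \<phi> p = (SUP q\<in>-{0}. (p \<bullet> q) / \<phi> q)"

definition subdifferential :: "(real^'n \<Rightarrow> real) \<Rightarrow> real^'n \<Rightarrow> (real^'n) set" where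
  "subdifferential f p = {q. \<forall>p'. f p + q \<bullet> (p' - p) \<le> f p'}"

definition tangent_space :: "real^'n \<Rightarrow> (real^'n \<Rightarrow> real) \<Rightarrow> (real^'n) set" where
  "tangent_space p \<phi> = {v. \<forall>q\<in>subdifferential (dual_norm \<phi>) p. v \<bullet> q = 0}"

(* Meaningful when V is a subspace, see orth_proj_unique below. *)
definition orth_proj :: "(real^'n) set \<Rightarrow> real^'n \<Rightarrow> real^'n" where
  "orth_proj V x = (THE y. y \<in> V \<and> (\<forall>v\<in>V. (x - y) \<bullet> v = 0))"

definition sym_matrices_on :: "(real^'n) set \<Rightarrow> (real^'n^'n) set" where
  "sym_matrices_on V =
     {X. transpose X = X \<and> matrix (orth_proj V) ** X ** matrix (orth_proj V) = X}"

definition shielding_space :: "real^'n \<Rightarrow> (real^'n \<Rightarrow> real) \<Rightarrow> (real^'n^'n) set" where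
  "shielding_space p \<phi> = sym_matrices_on {a + b |a b. a \<in> span {p} \<and> b \<in> tangent_space p \<phi>}"

definition gradient :: "(real^'n \<Rightarrow> real) \<Rightarrow> real^'n \<Rightarrow> real^'n" where
  "gradient f x = (THE D. GDERIV f x :> D)"

definition hessian :: "(real^'n \<Rightarrow> real) \<Rightarrow> real^'n \<Rightarrow> real^'n^'n" where
  "hessian f x = jacobian (gradient f) (at x)"

(* Intended for open S, since the derivatives are taken at x without restriction to S. *)
definition C2_on :: "(real^'n) set \<Rightarrow> (real^'n \<Rightarrow> real) \<Rightarrow> bool" where
  "C2_on S f \<longleftrightarrow>
     (\<forall>x\<in>S. f differentiable (at x)) \<and>
     (\<forall>x\<in>S. gradient f differentiable (at x)) \<and>
     continuous_on S (hessian f)"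

definition shielding_norm :: "(real^'n \<Rightarrow> real) \<Rightarrow> (real^'n \<Rightarrow> real) \<Rightarrow> bool" where
  "shielding_norm \<phi> \<psi> \<longleftrightarrow>
     finsler_norm \<psi> \<and> C2_on (-{0}) \<psi> \<and>
     (\<forall>q. q \<noteq> 0 \<longrightarrow> hessian \<psi> q \<in> shielding_space (gradient \<psi> q) \<phi>)"

lemma gradient_eq:
  assumes "GDERIV f x :> D"
  shows "gradient f x = D"
proof -
  have "D' = D" if "GDERIV f x :> D'" for D'
  proof -
    have "(\<lambda>h. h \<bullet> D') = (\<lambda>h. h \<bullet> D)"
      using that assms unfolding gderiv_def by (rule has_derivative_unique)
    then have "\<forall>h. h \<bullet> D' = h \<bullet> D" by (simp add: fun_eq_iff)
    then show ?thesis using vector_eq_ldot[of D' D] by (simp add: inner_commute)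
  qed
  then show ?thesis unfolding gradient_def using assms by (intro the_equality)
qed

lemma differentiable_gradient:
  assumes "f differentiable (at x)"
  shows "GDERIV f x :> gradient f x"
proof -
  obtain f' where f': "(f has_derivative f') (at x)"
    using assms unfolding differentiable_def by blast
  then have lin: "linear f'" by (rule has_derivative_linear)
  have "f' = (\<lambda>h. h \<bullet> adjoint f' 1)"
  proof
    fix h show "f' h = h \<bullet> adjoint f' 1"
      using adjoint_works[OF lin, of h 1] by simp
  qed
  then have "GDERIV f x :> adjoint f' 1"
    using f' unfolding gderiv_def by simp
  then show ?thesis by (simp add: gradient_eq)
qed

lemma orth_proj_unique:
  fixes V :: "(real^'n) set"
  assumes "subspace V"
  shows "\<exists>!y. y \<in> V \<and> (\<forall>v\<in>V. (x - y) \<bullet> v = 0)"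
proof -
  obtain y z where y: "y \<in> span V" and z: "\<And>w. w \<in> span V \<Longrightarrow> orthogonal z w" and x: "x = y + z"
    using orthogonal_subspace_decomp_exists[of V x] by blast
  have V: "span V = V" using assms by (simp add: span_eq_iff)
  show ?thesis
  proof (rule ex1I[of _ y])
    show "y \<in> V \<and> (\<forall>v\<in>V. (x - y) \<bullet> v = 0)"
      using y z x V by (auto simp: orthogonal_def)
    fix y' assume y': "y' \<in> V \<and> (\<forall>v\<in>V. (x - y') \<bullet> v = 0)"
    have "y' - y \<in> V" using y y' V assms by (auto intro: subspace_diff)
    then have "(x - y') \<bullet> (y' - y) = 0" "(x - y) \<bullet> (y' - y) = 0"
      using y' z x V by (auto simp: orthogonal_def)
    then have "(y' - y) \<bullet> (y' - y) = 0"
      by (simp add: inner_diff_left)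
    then show "y' = y" by simp
  qed
qed

lemma finsler_norm_pos:
  assumes "finsler_norm \<phi>" "q \<noteq> 0"
  shows "0 < \<phi> q"
proof -
  obtain q0 where "\<forall>q. q \<noteq> 0 \<longrightarrow> \<phi> q0 / norm q0 \<le> \<phi> q / norm q" "0 < \<phi> q0 / norm q0"
    using assms(1) unfolding finsler_norm_def by blast
  with assms(2) have "0 < \<phi> q / norm q" by (meson less_le_trans)
  with assms(2) show ?thesis by (simp add: zero_less_divide_iff)
qed

lemma finsler_norm_zero:
  fixes \<phi> :: "real^'n \<Rightarrow> real"
  assumes "finsler_norm \<phi>"
  shows "\<phi> 0 = 0"
proof -
  have "\<And>q t. 0 < t \<Longrightarrow> \<phi> (t *\<^sub>R q) = t * \<phi> q"
    using assms unfolding finsler_norm_def by blast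
  from this[of 2 0] have "\<phi> (2 *\<^sub>R 0) = 2 * \<phi> 0" by simp
  then show ?thesis by simp
qed

lemma finsler_norm_continuous:
  fixes \<phi> :: "real^'n \<Rightarrow> real"
  assumes "finsler_norm \<phi>"
  shows "continuous_on S \<phi>"
proof -
  have hom: "\<phi> (t *\<^sub>R q) = t * \<phi> q" if "0 \<le> t" for t q
  proof (cases "t = 0")
    case True
    then show ?thesis using finsler_norm_zero[OF assms] by simp
  next
    case False
    then show ?thesis using assms that unfolding finsler_norm_def by simp
  qed
  have "convex_on UNIV \<phi>"
    unfolding convex_on_def
  proof (intro conjI allI ballI impI)
    fix x y :: "real^'n" and u v :: real
    assume "0 \<le> u" "0 \<le> v" "u + v = 1"
    moreover have "\<phi> (u *\<^sub>R x + v *\<^sub>R y) \<le> \<phi> (u *\<^sub>R x) + \<phi> (v *\<^sub>R y)"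
      using assms unfolding finsler_norm_def by blast
    ultimately show "\<phi> (u *\<^sub>R x + v *\<^sub>R y) \<le> u * \<phi> x + v * \<phi> y"
      by (simp add: hom)
  qed simp
  then have "continuous_on UNIV \<phi>"
    by (rule convex_on_continuous[OF open_UNIV])
  then show ?thesis by (rule continuous_on_subset) simp
qed

lemma dual_norm_attained:
  fixes \<phi> :: "real^'n \<Rightarrow> real"
  assumes "finsler_norm \<phi>"
  obtains q where "q \<noteq> 0" "dual_norm \<phi> p = (p \<bullet> q) / \<phi> q"
    "\<And>r. r \<noteq> 0 \<Longrightarrow> (p \<bullet> r) / \<phi> r \<le> dual_norm \<phi> p"
proof -
  let ?f = "\<lambda>q. (p \<bullet> q) / \<phi> q"
  have "\<phi> q \<noteq> 0" if "q \<in> sphere 0 1" for q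
    using finsler_norm_pos[OF assms, of q] that by (cases "q = 0") auto
  then have "continuous_on (sphere 0 1) ?f"
    by (intro continuous_on_divide continuous_intros finsler_norm_continuous[OF assms]) blast
  moreover have "sphere (0::real^'n) 1 \<noteq> {}" by simp
  ultimately obtain q where q: "q \<in> sphere 0 1" and max: "\<forall>y\<in>sphere 0 1. ?f y \<le> ?f q"
    using continuous_attains_sup[of "sphere 0 1" ?f] by auto
  have q0: "q \<noteq> 0" using q by auto
  have le: "?f r \<le> ?f q" if "r \<noteq> 0" for r
  proof -
    have "\<phi> (inverse (norm r) *\<^sub>R r) = inverse (norm r) * \<phi> r"
      using assms that unfolding finsler_norm_def by simp
    then have "?f r = ?f (inverse (norm r) *\<^sub>R r)" using that by simp
    also have "\<dots> \<le> ?f q" using that by (intro bspec[OF max]) simp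
    finally show ?thesis .
  qed
  have "dual_norm \<phi> p = ?f q"
    unfolding dual_norm_def using q0 le by (intro cSup_eq_maximum) auto
  with q0 le show thesis by (intro that[of q]) auto
qed

lemma uniform_distance_le_iff:
  fixes \<phi> \<psi> :: "real^'n \<Rightarrow> real"
  assumes "finsler_norm \<phi>" "finsler_norm \<psi>"
  shows "(SUP e\<in>sphere 0 1. \<bar>\<psi> e - \<phi> e\<bar>) \<le> \<delta> \<longleftrightarrow> (\<forall>e\<in>sphere 0 1. \<bar>\<psi> e - \<phi> e\<bar> \<le> \<delta>)"
proof (rule cSUP_le_iff)
  have "compact ((\<lambda>e. \<bar>\<psi> e - \<phi> e\<bar>) ` sphere 0 1)"
    by (intro compact_continuous_image continuous_intros finsler_norm_continuous assms) simp
  then show "bdd_above ((\<lambda>e. \<bar>\<psi> e - \<phi> e\<bar>) ` sphere 0 1)"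
    by (intro bounded_imp_bdd_above compact_imp_bounded)
qed simp

end

theory Submission
  imports Defs
begin

text \<open>
  Let \<open>\<phi> q\<close> be the maximum of \<open>p \<bullet> q\<close> over the finite set \<open>P\<close>. The dual unit ball is then the
  polytope \<open>conv P\<close>, and \<open>tangent_space N \<phi>\<close> is the direction space of the smallest face of this
  polytope whose cone contains \<open>N\<close>. Hence a shielding norm is a smooth norm whose gradient, to
  first order, moves only within the linear span of the face over which it lies.

  The polytope \<open>{\<phi> \<le> 1}\<close> is smoothed by adding up one-sided cubic penalties:
  \<open>f x = (\<Sum>p\<in>P. (max 0 (p \<bullet> x - 1)) ^ 3)\<close> is convex and twice continuously differentiable, and
  \<open>\<psi>\<close> is the gauge of the convex body \<open>{f \<le> \<epsilon> ^ 3}\<close>. The penalties have the decisive property that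
  only the vectors \<open>p\<close> with \<open>p \<bullet> x > 1\<close> contribute to \<open>f\<close> and its derivatives at \<open>x\<close>. With
  \<open>G = (\<Sum>p\<in>P. 3 * (max 0 (p \<bullet> x - 1))\<^sup>2 *\<^sub>R p)\<close> the gradient of \<open>f\<close> at \<open>x\<close>, the vector
  \<open>N = G / (G \<bullet> x)\<close> is the conormal to the level set at \<open>x\<close>, normalised by \<open>N \<bullet> x = 1\<close>.

  Convexity of \<open>f\<close> says that \<open>\<psi> q\<close> is the maximum of \<open>N \<bullet> q\<close> over all conormals \<open>N\<close>, attained at the
  point \<open>x = q / \<psi> q\<close> of the level set. This makes \<open>\<psi>\<close> a Finsler norm, shows that \<open>N\<close> is a
  subgradient of \<open>\<psi>\<close> at \<open>q\<close>, and, since \<open>N\<close> depends continuously on \<open>q\<close>, that it is the gradient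
  (\<open>GDERIV_smooth_gauge\<close>). Differentiating \<open>N\<close> once more gives the Hessian as a sum of multiples
  of \<open>u u\<^sup>T\<close> with \<open>u = p - (p \<bullet> x) N\<close>, over those \<open>p\<close> with \<open>p \<bullet> x > 1\<close> (\<open>hessian_smooth_gauge\<close>).

  On the level set, \<open>1 < \<phi> x \<le> 1 + \<epsilon>\<close>. By compactness of the sphere and finiteness of \<open>P\<close>, for
  small \<open>\<epsilon>\<close> all \<open>p\<close> with \<open>p \<bullet> x > 1\<close> lie on one proper face of \<open>conv P\<close>
  (\<open>nearly_active_on_common_face\<close>). As \<open>N\<close> is a positive combination of them, each of them
  belongs to the sum of the line through \<open>N\<close> and \<open>tangent_space N \<phi>\<close>
  (\<open>face_subset_shielding_subspace\<close>), and with them so does every \<open>u\<close>. Finally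
  \<open>\<psi> q \<le> \<phi> q \<le> (1 + \<epsilon>) \<psi> q\<close>, so that \<open>\<psi>\<close> is as close to \<open>\<phi>\<close> as desired.
\<close>

section \<open>Truncated powers\<close>

lemma has_real_derivative_max_power:
  fixes t :: real
  shows "((\<lambda>t. max 0 t ^ Suc (Suc n)) has_real_derivative real (Suc (Suc n)) * max 0 t ^ Suc n) (at t)"
proof -
  consider "t < 0" | "t > 0" | "t = 0" by linarith
  then show ?thesis
  proof cases
    case 1
    have "((\<lambda>t::real. 0) has_real_derivative 0) (at t)" by simp
    then have "((\<lambda>t::real. max 0 t ^ Suc (Suc n)) has_real_derivative 0) (at t)"
      by (rule has_field_derivative_transform_within_open[where S = "{..<0}"]) (use 1 in auto)
    with 1 show ?thesis by simp
  next
    case 2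
    have "((\<lambda>t::real. t ^ Suc (Suc n)) has_real_derivative real (Suc (Suc n)) * t ^ Suc n) (at t)"
      by (rule derivative_eq_intros refl)+ simp
    then have "((\<lambda>t::real. max 0 t ^ Suc (Suc n)) has_real_derivative real (Suc (Suc n)) * t ^ Suc n) (at t)"
      by (rule has_field_derivative_transform_within_open[where S = "{0<..}"]) (use 2 in auto)
    with 2 show ?thesis by simp
  next
    case 3
    have "((\<lambda>h::real. max 0 h ^ Suc n) \<longlongrightarrow> max 0 0 ^ Suc n) (at 0)"
      by (intro tendsto_intros)
    then have "((\<lambda>h::real. max 0 h ^ Suc n) \<longlongrightarrow> 0) (at 0)" by simp
    then have "((\<lambda>h::real. max 0 h ^ Suc (Suc n) / h) \<longlongrightarrow> 0) (at 0)"
      by (rule Lim_transform_eventually)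
        (auto simp: eventually_at max_def intro!: exI[of _ 1])
    with 3 show ?thesis by (simp add: DERIV_def)
  qed
qed

text \<open>
  With the positive parts \<open>A\<close> and \<open>B\<close> of \<open>a\<close> and \<open>b\<close>, the gap in this convexity inequality is at
  least \<open>(B - A)\<^sup>2 (B + 2 A)\<close>.
\<close>

lemma max_cube_ge_tangent:
  fixes a b :: real
  shows "max 0 a ^ 3 + 3 * (max 0 a)\<^sup>2 * (b - a) \<le> max 0 b ^ 3"
proof -
  define A B where "A = max 0 a" and "B = max 0 b"
  have nn: "0 \<le> A" "0 \<le> B" by (auto simp: A_def B_def)
  have "A\<^sup>2 * (b - a) \<le> A\<^sup>2 * (B - A)"
    by (cases "a > 0") (auto simp: A_def B_def intro!: mult_left_mono)
  moreover have "B ^ 3 - A ^ 3 - 3 * A\<^sup>2 * (B - A) = (B - A)\<^sup>2 * (B + 2 * A)"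
    by (simp add: power2_eq_square power3_eq_cube algebra_simps)
  moreover have "0 \<le> (B - A)\<^sup>2 * (B + 2 * A)" using nn by simp
  ultimately show ?thesis unfolding A_def[symmetric] B_def[symmetric] by linarith
qed

section \<open>The gauge of a smoothed polytope\<close>

text \<open>
  The condition on directions says that \<open>0\<close> is interior to \<open>conv P\<close>, equivalently that the
  polyhedron \<open>{x. \<forall>p\<in>P. p \<bullet> x \<le> 1}\<close> is bounded. The number \<open>\<epsilon>\<close> bounds by how much the smoothed body
  may exceed the constraints \<open>p \<bullet> x \<le> 1\<close>, which is why the level below is \<open>\<epsilon> ^ 3\<close>.
\<close>

locale smoothed_polytope =
  fixes P :: "(real^'n) set" and \<epsilon> :: real
  assumes finite_P: "finite P"
    and eps_pos: "0 < \<epsilon>"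
    and positive_direction: "q \<noteq> 0 \<Longrightarrow> \<exists>p\<in>P. 0 < p \<bullet> q"
begin

definition excess :: "real^'n \<Rightarrow> real^'n \<Rightarrow> real" where
  "excess p x = max 0 (p \<bullet> x - 1)"

definition penalty :: "real^'n \<Rightarrow> real" where
  "penalty x = (\<Sum>p\<in>P. excess p x ^ 3)"

definition penalty_grad :: "real^'n \<Rightarrow> real^'n" where
  "penalty_grad x = (\<Sum>p\<in>P. (3 * (excess p x)\<^sup>2) *\<^sub>R p)"

text \<open>
  On the level set this is the point of the polar body of \<open>{penalty \<le> \<epsilon> ^ 3}\<close> dual to \<open>x\<close>.
\<close>

definition conormal :: "real^'n \<Rightarrow> real^'n" where
  "conormal x = penalty_grad x /\<^sub>R (penalty_grad x \<bullet> x)"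

text \<open>
  The Minkowski gauge of \<open>{penalty \<le> \<epsilon> ^ 3}\<close>: every ray from the origin meets the boundary of this
  body exactly once, and \<open>foot q\<close> is the boundary point on the ray through \<open>q\<close>.
\<close>

definition smooth_gauge :: "real^'n \<Rightarrow> real" where
  "smooth_gauge q = (if q = 0 then 0 else THE t. 0 < t \<and> penalty (q /\<^sub>R t) = \<epsilon> ^ 3)"

definition foot :: "real^'n \<Rightarrow> real^'n" where
  "foot q = q /\<^sub>R smooth_gauge q"

lemma excess_nonneg: "0 \<le> excess p x"
  by (simp add: excess_def)

lemma penalty_ge_tangent:
  "penalty x + penalty_grad x \<bullet> (y - x) \<le> penalty y"
proof -
  have "penalty x + penalty_grad x \<bullet> (y - x)
      = (\<Sum>p\<in>P. excess p x ^ 3 + 3 * (excess p x)\<^sup>2 * ((p \<bullet> y - 1) - (p \<bullet> x - 1)))"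
    by (simp add: penalty_def penalty_grad_def inner_sum_left sum.distrib inner_diff_right
        right_diff_distrib sum_subtractf)
  also have "\<dots> \<le> penalty y"
    unfolding penalty_def excess_def by (intro sum_mono max_cube_ge_tangent)
  finally show ?thesis .
qed

lemma exists_active:
  assumes "penalty x = \<epsilon> ^ 3"
  shows "\<exists>p\<in>P. 1 < p \<bullet> x"
proof (rule ccontr)
  assume "\<not> ?thesis"
  then have "penalty x = 0"
    unfolding penalty_def excess_def by (intro sum.neutral) auto
  with assms eps_pos show False by simp
qed

lemma inner_le_on_level:
  assumes "penalty x = \<epsilon> ^ 3" and "p \<in> P"
  shows "p \<bullet> x \<le> 1 + \<epsilon>"
proof -
  have "excess p x ^ 3 \<le> penalty x"
    unfolding penalty_def using finite_P assms(2) excess_nonneg by (intro member_le_sum) auto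
  then have "excess p x \<le> \<epsilon>"
    using assms(1) eps_pos by (simp add: power_mono_iff excess_nonneg)
  then show ?thesis by (simp add: excess_def)
qed

lemma penalty_grad_inner_pos:
  assumes "penalty x = \<epsilon> ^ 3"
  shows "0 < penalty_grad x \<bullet> x"
proof -
  obtain p where p: "p \<in> P" "1 < p \<bullet> x" using exists_active[OF assms] by blast
  have "0 < (\<Sum>p\<in>P. 3 * (excess p x)\<^sup>2 * (p \<bullet> x))"
  proof (rule sum_pos2[OF finite_P p(1)])
    show "0 < 3 * (excess p x)\<^sup>2 * (p \<bullet> x)" using p(2) by (simp add: excess_def)
    show "0 \<le> 3 * (excess p' x)\<^sup>2 * (p' \<bullet> x)" for p'
      by (cases "p' \<bullet> x \<le> 1") (auto simp: excess_def)
  qed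
  then show ?thesis by (simp add: penalty_grad_def inner_sum_left)
qed

lemma conormal_inner_self:
  assumes "penalty x = \<epsilon> ^ 3"
  shows "conormal x \<bullet> x = 1"
  using penalty_grad_inner_pos[OF assms] by (simp add: conormal_def)

text \<open>
  The tangent hyperplane at \<open>x\<close> supports the convex body bounded by the level set. This inequality
  yields uniqueness in the definition of the gauge, the triangle inequality and the subgradient
  estimates.
\<close>

lemma conormal_inner_le:
  assumes "penalty x = \<epsilon> ^ 3" and "penalty y = \<epsilon> ^ 3"
  shows "conormal x \<bullet> y \<le> 1"
proof -
  have "penalty_grad x \<bullet> y \<le> penalty_grad x \<bullet> x"
    using penalty_ge_tangent[of x y] assms by (simp add: inner_diff_right)
  then show ?thesis
    using penalty_grad_inner_pos[OF assms(1)] by (simp add: conormal_def field_simps)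
qed

lemma smooth_gauge_unique:
  assumes "0 < s" "penalty (q /\<^sub>R s) = \<epsilon> ^ 3" "0 < t" "penalty (q /\<^sub>R t) = \<epsilon> ^ 3"
  shows "s = t"
proof -
  have le: "s \<le> t"
    if "0 < s" "penalty (q /\<^sub>R s) = \<epsilon> ^ 3" "0 < t" "penalty (q /\<^sub>R t) = \<epsilon> ^ 3" for s t
  proof -
    have "conormal (q /\<^sub>R s) \<bullet> q = s"
      using conormal_inner_self[OF that(2)] that(1) by (simp add: field_simps)
    moreover have "conormal (q /\<^sub>R s) \<bullet> q \<le> t"
      using conormal_inner_le[OF that(2,4)] that(3) by (simp add: field_simps)
    ultimately show ?thesis by simp
  qed
  from le[of s t] le[of t s] assms show ?thesis by simp
qed

text \<open>
  Along the ray through \<open>q\<close> the penalty grows from \<open>0\<close> without bound because some constraint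
  is violated far out.
\<close>

lemma smooth_gauge_exists:
  assumes "q \<noteq> 0"
  shows "\<exists>t>0. penalty (q /\<^sub>R t) = \<epsilon> ^ 3"
proof -
  obtain p where p: "p \<in> P" "0 < p \<bullet> q" using positive_direction[OF assms] by blast
  \<comment> \<open>at this parameter the single summand of \<open>p\<close> already reaches the level\<close>
  define b where "b = (1 + \<epsilon>) / (p \<bullet> q)"
  have b: "0 \<le> b" "p \<bullet> (b *\<^sub>R q) = 1 + \<epsilon>" using p(2) eps_pos by (auto simp: b_def)
  have zero: "penalty (0 *\<^sub>R q) = 0" by (simp add: penalty_def excess_def)
  have "\<epsilon> ^ 3 = excess p (b *\<^sub>R q) ^ 3" using b eps_pos by (simp add: excess_def)
  also have "\<dots> \<le> penalty (b *\<^sub>R q)"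
    unfolding penalty_def using finite_P p(1) excess_nonneg by (intro member_le_sum) auto
  finally have hi: "\<epsilon> ^ 3 \<le> penalty (b *\<^sub>R q)" .
  have "continuous_on {0..b} (\<lambda>s. penalty (s *\<^sub>R q))"
    unfolding penalty_def excess_def by (intro continuous_intros)
  then obtain s where s: "0 \<le> s" "penalty (s *\<^sub>R q) = \<epsilon> ^ 3"
    using IVT'[of "\<lambda>s. penalty (s *\<^sub>R q)" 0 "\<epsilon> ^ 3" b] zero hi b(1) eps_pos by auto
  have "s \<noteq> 0" using s(2) zero eps_pos by auto
  with s show ?thesis by (intro exI[of _ "inverse s"]) auto
qed

lemma smooth_gauge:
  assumes "q \<noteq> 0"
  shows smooth_gauge_pos: "0 < smooth_gauge q"
    and penalty_foot: "penalty (foot q) = \<epsilon> ^ 3"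
proof -
  have "\<exists>!t. 0 < t \<and> penalty (q /\<^sub>R t) = \<epsilon> ^ 3"
    using smooth_gauge_exists[OF assms] smooth_gauge_unique by blast
  from theI'[OF this] show "0 < smooth_gauge q" "penalty (foot q) = \<epsilon> ^ 3"
    using assms by (simp_all add: smooth_gauge_def foot_def)
qed

lemma smooth_gauge_eqI:
  assumes "0 < t" "penalty (q /\<^sub>R t) = \<epsilon> ^ 3" "q \<noteq> 0"
  shows "smooth_gauge q = t"
  using smooth_gauge_unique[of "smooth_gauge q" q t] smooth_gauge[OF assms(3)] assms
  by (simp add: foot_def)

lemma smooth_gauge_zero [simp]: "smooth_gauge 0 = 0"
  by (simp add: smooth_gauge_def)

lemma smooth_gauge_nonneg: "0 \<le> smooth_gauge q"
  using smooth_gauge_pos[of q] by (cases "q = 0") auto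

lemma smooth_gauge_scale_foot: "q \<noteq> 0 \<Longrightarrow> q = smooth_gauge q *\<^sub>R foot q"
  using smooth_gauge_pos[of q] by (simp add: foot_def)

lemma smooth_gauge_scale:
  assumes "0 < t"
  shows "smooth_gauge (t *\<^sub>R q) = t * smooth_gauge q"
proof (cases "q = 0")
  case False
  show ?thesis
  proof (rule smooth_gauge_eqI)
    have "(t *\<^sub>R q) /\<^sub>R (t * smooth_gauge q) = foot q" using assms by (simp add: foot_def field_simps)
    then show "penalty ((t *\<^sub>R q) /\<^sub>R (t * smooth_gauge q)) = \<epsilon> ^ 3"
      using penalty_foot[OF False] by simp
  qed (use False assms smooth_gauge_pos[OF False] in auto)
qed simp

lemma conormal_inner_le_gauge:
  assumes "penalty x = \<epsilon> ^ 3"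
  shows "conormal x \<bullet> q \<le> smooth_gauge q"
proof (cases "q = 0")
  case False
  have "conormal x \<bullet> q = smooth_gauge q * (conormal x \<bullet> foot q)"
    by (subst smooth_gauge_scale_foot[OF False]) simp
  also have "\<dots> \<le> smooth_gauge q"
    using conormal_inner_le[OF assms penalty_foot[OF False]] smooth_gauge_pos[OF False]
    by (simp add: mult_left_le)
  finally show ?thesis .
qed simp

lemma conormal_foot_inner:
  assumes "q \<noteq> 0"
  shows "conormal (foot q) \<bullet> q = smooth_gauge q"
proof -
  have "conormal (foot q) \<bullet> q = smooth_gauge q * (conormal (foot q) \<bullet> foot q)"
    by (subst (2) smooth_gauge_scale_foot[OF assms]) simp
  then show ?thesis using conormal_inner_self[OF penalty_foot[OF assms]] by simp
qed

text \<open>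
  The gauge is a maximum of linear functionals by the two preceding facts; the maximiser for
  \<open>q1 + q2\<close> bounds both summands.
\<close>

lemma smooth_gauge_subadd: "smooth_gauge (q1 + q2) \<le> smooth_gauge q1 + smooth_gauge q2"
proof (cases "q1 + q2 = 0")
  case True
  then show ?thesis using smooth_gauge_nonneg[of q1] smooth_gauge_nonneg[of q2] by simp
next
  case False
  show ?thesis
    using conormal_foot_inner[OF False] conormal_inner_le_gauge[OF penalty_foot[OF False], of q1]
      conormal_inner_le_gauge[OF penalty_foot[OF False], of q2]
    by (simp add: inner_add_right)
qed

text \<open>
  Sublinear functions are convex, and finite convex functions on a finite-dimensional space are
  continuous. Attainment of the minimum in the definition of a Finsler norm rests on this.
\<close>

lemma smooth_gauge_continuous: "continuous_on S smooth_gauge"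
proof -
  have hom: "smooth_gauge (t *\<^sub>R q) = t * smooth_gauge q" if "0 \<le> t" for t q
    using smooth_gauge_scale[of t q] that by (cases "t = 0") auto
  have "convex_on UNIV smooth_gauge"
    unfolding convex_on_def
  proof (intro conjI allI ballI impI)
    fix x y :: "real^'n" and u v :: real
    assume "0 \<le> u" "0 \<le> v"
    then show "smooth_gauge (u *\<^sub>R x + v *\<^sub>R y) \<le> u * smooth_gauge x + v * smooth_gauge y"
      using smooth_gauge_subadd[of "u *\<^sub>R x" "v *\<^sub>R y"] by (simp add: hom)
  qed simp
  then have "continuous_on UNIV smooth_gauge" by (rule convex_on_continuous[OF open_UNIV])
  then show ?thesis by (rule continuous_on_subset) simp
qed

lemma finsler_norm_smooth_gauge: "finsler_norm smooth_gauge"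
proof -
  have "sphere (0::real^'n) 1 \<noteq> {}" by simp
  then obtain q0 :: "real^'n"
    where q0: "q0 \<in> sphere 0 1" and min: "\<forall>y\<in>sphere 0 1. smooth_gauge q0 \<le> smooth_gauge y"
    using continuous_attains_inf[of "sphere (0::real^'n) 1" smooth_gauge] smooth_gauge_continuous
    by auto
  have "q0 \<noteq> 0" using q0 by auto
  moreover have "smooth_gauge q0 / norm q0 \<le> smooth_gauge q / norm q" if "q \<noteq> 0" for q
  proof -
    have "smooth_gauge q0 \<le> smooth_gauge (inverse (norm q) *\<^sub>R q)"
      using that by (intro bspec[OF min]) simp
    then show ?thesis using that q0 by (simp add: smooth_gauge_scale field_simps)
  qed
  moreover have "0 < smooth_gauge q0 / norm q0"
    using smooth_gauge_pos[OF \<open>q0 \<noteq> 0\<close>] \<open>q0 \<noteq> 0\<close> by simp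
  ultimately show ?thesis
    unfolding finsler_norm_def
    using smooth_gauge_nonneg smooth_gauge_scale smooth_gauge_subadd by blast
qed

section \<open>First and second derivative of the gauge\<close>

lemma continuous_foot: "continuous_on (-{0}) foot"
proof -
  have "smooth_gauge q \<noteq> 0" if "q \<in> -{0}" for q using smooth_gauge_pos[of q] that by auto
  then show ?thesis
    unfolding foot_def by (intro continuous_intros smooth_gauge_continuous) auto
qed

lemma continuous_excess: "continuous_on S (excess p)"
  unfolding excess_def by (intro continuous_intros)

lemma continuous_penalty_grad: "continuous_on S penalty_grad"
  unfolding penalty_grad_def by (intro continuous_intros continuous_excess)

lemma continuous_excess_foot: "continuous_on (-{0}) (\<lambda>q. excess p (foot q))"
  using continuous_on_compose[OF continuous_foot continuous_excess] by (simp add: o_def)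

lemma continuous_grad_foot: "continuous_on (-{0}) (\<lambda>q. penalty_grad (foot q))"
  using continuous_on_compose[OF continuous_foot continuous_penalty_grad] by (simp add: o_def)

lemma continuous_conormal_foot: "continuous_on (-{0}) (\<lambda>q. conormal (foot q))"
proof -
  have "penalty_grad (foot q) \<bullet> foot q \<noteq> 0" if "q \<in> -{0}" for q
    using penalty_grad_inner_pos[OF penalty_foot[of q]] that by auto
  then show ?thesis
    unfolding conormal_def by (intro continuous_intros continuous_grad_foot continuous_foot) auto
qed

text \<open>
  Write \<open>N q\<close> for the conormal at \<open>foot q\<close>. Since \<open>N q\<close> and \<open>N y\<close> are subgradients of the
  gauge at \<open>q\<close> and at \<open>y\<close>, the increment from \<open>q\<close> to \<open>y\<close> lies between \<open>(y - q) \<bullet> N q\<close> and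
  \<open>(y - q) \<bullet> N y\<close>; continuity of \<open>N\<close> makes the difference of these bounds of lower order.
\<close>

lemma GDERIV_smooth_gauge:
  assumes "q \<noteq> 0"
  shows "GDERIV smooth_gauge q :> conormal (foot q)"
proof -
  let ?N = "\<lambda>q. conormal (foot q)"
  have "isCont ?N q"
    using continuous_conormal_foot assms by (simp add: continuous_on_eq_continuous_at open_Compl)
  then have small: "\<forall>\<^sub>F y in at q. dist (?N y) (?N q) < e" if "0 < e" for e
    using that by (auto simp: isCont_def tendsto_iff)
  have nz: "\<forall>\<^sub>F y in at q. y \<noteq> 0"
    using assms tendsto_imp_eventually_ne[OF tendsto_ident_at, of q 0 UNIV] by simp
  have "(smooth_gauge has_derivative (\<lambda>h. h \<bullet> ?N q)) (at q)"
    unfolding has_derivative_iff_norm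
  proof (intro conjI bounded_linear_inner_left)
    show "((\<lambda>y. norm (smooth_gauge y - smooth_gauge q - (y - q) \<bullet> ?N q) / norm (y - q)) \<longlongrightarrow> 0) (at q)"
    proof (rule tendstoI)
      fix e :: real assume "0 < e"
      from small[OF this] nz
      show "\<forall>\<^sub>F y in at q. dist (norm (smooth_gauge y - smooth_gauge q - (y - q) \<bullet> ?N q) / norm (y - q)) 0 < e"
      proof eventually_elim
        case (elim y)
        have lo: "(y - q) \<bullet> ?N q \<le> smooth_gauge y - smooth_gauge q"
          using conormal_inner_le_gauge[OF penalty_foot[OF assms], of y] conormal_foot_inner[OF assms]
          by (simp add: inner_diff_left inner_commute)
        have hi: "smooth_gauge y - smooth_gauge q \<le> (y - q) \<bullet> ?N y"
          using conormal_inner_le_gauge[OF penalty_foot[OF elim(2)], of q] conormal_foot_inner[OF elim(2)]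
          by (simp add: inner_diff_left inner_commute)
        have "norm (smooth_gauge y - smooth_gauge q - (y - q) \<bullet> ?N q) \<le> (y - q) \<bullet> (?N y - ?N q)"
          using lo hi by (simp add: inner_diff_right)
        also have "\<dots> \<le> norm (y - q) * norm (?N y - ?N q)"
          by (rule norm_cauchy_schwarz)
        finally have "norm (smooth_gauge y - smooth_gauge q - (y - q) \<bullet> ?N q) / norm (y - q) \<le> norm (?N y - ?N q)"
          by (cases "y = q") (auto simp: divide_le_eq mult.commute)
        with elim(1) show ?case by (simp add: dist_norm)
      qed
    qed
  qed
  then show ?thesis by (simp add: gderiv_def)
qed

lemma gradient_smooth_gauge: "q \<noteq> 0 \<Longrightarrow> gradient smooth_gauge q = conormal (foot q)"
  by (intro gradient_eq GDERIV_smooth_gauge)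

lemma penalty_grad_has_derivative:
  "(penalty_grad has_derivative (\<lambda>h. \<Sum>p\<in>P. (6 * excess p x * (p \<bullet> h)) *\<^sub>R p)) (at x)"
proof -
  have "((\<lambda>x. (excess p x)\<^sup>2) has_derivative (\<lambda>h. (p \<bullet> h) * (2 * excess p x))) (at x)" for p
  proof -
    have "((\<lambda>t. (max 0 t)\<^sup>2) has_real_derivative 2 * max 0 (p \<bullet> x - 1)) (at (p \<bullet> x - 1))"
      using has_real_derivative_max_power[of 0 "p \<bullet> x - 1"] by (simp add: power2_eq_square)
    moreover have "((\<lambda>x. p \<bullet> x - 1) has_derivative (\<lambda>h. p \<bullet> h)) (at x)"
      by (auto intro!: derivative_eq_intros)
    ultimately show ?thesis
      unfolding excess_def by (rule DERIV_compose_FDERIV)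
  qed
  note d = this
  have "((\<lambda>x. (3 * (excess p x)\<^sup>2) *\<^sub>R p) has_derivative (\<lambda>h. (6 * excess p x * (p \<bullet> h)) *\<^sub>R p)) (at x)" for p
    by (rule derivative_eq_intros d refl)+ (simp add: fun_eq_iff)
  then show ?thesis unfolding penalty_grad_def by (intro has_derivative_sum)
qed

lemma foot_has_derivative:
  assumes "q \<noteq> 0"
  shows "(foot has_derivative
    (\<lambda>h. (h - (conormal (foot q) \<bullet> h) *\<^sub>R foot q) /\<^sub>R smooth_gauge q)) (at q)"
proof -
  have g: "(smooth_gauge has_derivative (\<lambda>h. h \<bullet> conormal (foot q))) (at q)"
    using GDERIV_smooth_gauge[OF assms] by (simp add: gderiv_def)
  have nz: "smooth_gauge q \<noteq> 0" using smooth_gauge_pos[OF assms] by simp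
  have "((\<lambda>q. q /\<^sub>R smooth_gauge q) has_derivative
    (\<lambda>h. (h - (conormal (foot q) \<bullet> h) *\<^sub>R foot q) /\<^sub>R smooth_gauge q)) (at q)"
    by (rule derivative_eq_intros g refl nz)+
      (simp add: fun_eq_iff foot_def algebra_simps inner_commute)
  then show ?thesis by (simp add: foot_def[abs_def])
qed

text \<open>
  Let \<open>x = foot q\<close>, \<open>N\<close> its conormal, \<open>k = penalty_grad x \<bullet> x\<close>, \<open>A\<close> the Hessian of the penalty at \<open>x\<close>
  and \<open>B = I - x N\<^sup>T\<close> the projection along \<open>x\<close> onto the tangent space of the level set. Then the
  Hessian of the gauge at \<open>q\<close> is \<open>B\<^sup>T A B / (k * smooth_gauge q)\<close>. Since \<open>A\<close> is the sum of
  \<open>6 * excess p x\<close> times \<open>p p\<^sup>T\<close>, it is a weighted sum of \<open>u u\<^sup>T\<close> where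
  \<open>u = B\<^sup>T p = p - (p \<bullet> x) N\<close>. In this form symmetry and the range can be read off.
\<close>

definition hessian_vec :: "real^'n \<Rightarrow> real^'n \<Rightarrow> real^'n" where
  "hessian_vec q p = p - (p \<bullet> foot q) *\<^sub>R conormal (foot q)"

definition hessian_weight :: "real^'n \<Rightarrow> real^'n \<Rightarrow> real" where
  "hessian_weight q p = 6 * excess p (foot q) / ((penalty_grad (foot q) \<bullet> foot q) * smooth_gauge q)"

lemma conormal_foot_has_derivative:
  assumes "q \<noteq> 0"
  shows "((\<lambda>q. conormal (foot q)) has_derivative
    (\<lambda>h. \<Sum>p\<in>P. (hessian_weight q p * (hessian_vec q p \<bullet> h)) *\<^sub>R hessian_vec q p)) (at q)"
proof -
  define x where "x = foot q"
  define N where "N = conormal x"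
  define G where "G = penalty_grad x"
  define k where "k = G \<bullet> x"
  define s where "s = smooth_gauge q"
  define v where "v h = (h - (N \<bullet> h) *\<^sub>R x) /\<^sub>R s" for h
  define A where "A w = (\<Sum>p\<in>P. (6 * excess p x * (p \<bullet> w)) *\<^sub>R p)" for w
  have k: "k \<noteq> 0" using penalty_grad_inner_pos[OF penalty_foot[OF assms]] by (simp add: k_def G_def x_def)
  have GN: "G = k *\<^sub>R N" using k by (simp add: N_def conormal_def G_def k_def)
  have Nx: "N \<bullet> x = 1" using conormal_inner_self[OF penalty_foot[OF assms]] by (simp add: N_def x_def)
  \<comment> \<open>\<open>v\<close>, the derivative of \<open>foot\<close>, is tangent to the level set, so the denominator in the
    quotient rule varies only through \<open>A\<close>\<close>
  have Gv: "G \<bullet> v h = 0" for h by (simp add: GN v_def inner_diff_right Nx)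
  have df: "(foot has_derivative v) (at q)"
    using foot_has_derivative[OF assms] by (simp add: v_def[abs_def] N_def x_def s_def)
  have dG: "((\<lambda>q. penalty_grad (foot q)) has_derivative (\<lambda>h. A (v h))) (at q)"
    using has_derivative_compose[OF df penalty_grad_has_derivative] by (simp add: A_def x_def)
  have nz: "penalty_grad (foot q) \<bullet> foot q \<noteq> 0" using k by (simp add: k_def G_def x_def)
  have "((\<lambda>q. penalty_grad (foot q) /\<^sub>R (penalty_grad (foot q) \<bullet> foot q)) has_derivative
      (\<lambda>h. (A (v h) - (A (v h) \<bullet> x) *\<^sub>R N) /\<^sub>R k)) (at q)"
  proof (rule derivative_eq_intros df dG refl nz)+
    show "(\<lambda>h. inverse (penalty_grad (foot q) \<bullet> foot q) *\<^sub>R A (v h)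
       + - (inverse (penalty_grad (foot q) \<bullet> foot q) * (penalty_grad (foot q) \<bullet> v h + A (v h) \<bullet> foot q) * inverse (penalty_grad (foot q) \<bullet> foot q)) *\<^sub>R penalty_grad (foot q))
       = (\<lambda>h. (A (v h) - (A (v h) \<bullet> x) *\<^sub>R N) /\<^sub>R k)"
      unfolding x_def[symmetric] G_def[symmetric] k_def[symmetric] Gv
      using k by (simp add: fun_eq_iff GN algebra_simps)
  qed
  moreover have "(A (v h) - (A (v h) \<bullet> x) *\<^sub>R N) /\<^sub>R k
      = (\<Sum>p\<in>P. (hessian_weight q p * (hessian_vec q p \<bullet> h)) *\<^sub>R hessian_vec q p)" for h
  proof -
    have pv: "p \<bullet> v h = (hessian_vec q p \<bullet> h) / s" for p
      by (simp add: v_def hessian_vec_def x_def[symmetric] N_def[symmetric] inner_diff_right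
          inner_diff_left divide_inverse mult.commute)
    have "A (v h) - (A (v h) \<bullet> x) *\<^sub>R N
        = (\<Sum>p\<in>P. (6 * excess p x * (p \<bullet> v h)) *\<^sub>R hessian_vec q p)"
      by (simp add: A_def hessian_vec_def x_def[symmetric] N_def[symmetric] inner_sum_left
          scaleR_sum_left scaleR_diff_right sum_subtractf)
    then have "(A (v h) - (A (v h) \<bullet> x) *\<^sub>R N) /\<^sub>R k
        = (\<Sum>p\<in>P. (inverse k * (6 * excess p x * (p \<bullet> v h))) *\<^sub>R hessian_vec q p)"
      by (simp add: scaleR_sum_right)
    also have "\<dots> = (\<Sum>p\<in>P. (hessian_weight q p * (hessian_vec q p \<bullet> h)) *\<^sub>R hessian_vec q p)"
      by (intro sum.cong refl arg_cong2[where f = scaleR])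
        (simp add: pv hessian_weight_def x_def[symmetric] G_def[symmetric] k_def[symmetric]
          s_def[symmetric] field_simps)
    finally show ?thesis .
  qed
  ultimately show ?thesis by (simp add: conormal_def)
qed

lemma gradient_has_derivative:
  assumes "q \<noteq> 0"
  shows "(gradient smooth_gauge has_derivative
    (\<lambda>h. \<Sum>p\<in>P. (hessian_weight q p * (hessian_vec q p \<bullet> h)) *\<^sub>R hessian_vec q p)) (at q)"
  using conormal_foot_has_derivative[OF assms]
  by (rule has_derivative_transform_within_open[where s = "-{0}"])
    (use assms in \<open>auto simp: gradient_smooth_gauge open_Compl\<close>)

lemma hessian_smooth_gauge:
  assumes "q \<noteq> 0"
  shows "hessian smooth_gauge q =
    (\<chi> i j. \<Sum>p\<in>P. hessian_weight q p * hessian_vec q p $ j * hessian_vec q p $ i)"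
  unfolding hessian_def jacobian_def frechet_derivative_at[OF gradient_has_derivative[OF assms], symmetric]
  by (simp add: matrix_def inner_axis)

lemma C2_smooth_gauge: "C2_on (-{0}) smooth_gauge"
proof -
  have nz: "penalty_grad (foot q) \<bullet> foot q \<noteq> 0" "smooth_gauge q \<noteq> 0" if "q \<in> -{0}" for q
    using penalty_grad_inner_pos[OF penalty_foot[of q]] smooth_gauge_pos[of q] that by auto
  have "continuous_on (-{0})
      (\<lambda>q. \<chi> i j. \<Sum>p\<in>P. hessian_weight q p * hessian_vec q p $ j * hessian_vec q p $ i)"
    unfolding hessian_weight_def hessian_vec_def
    using nz by (intro continuous_intros continuous_excess_foot continuous_grad_foot
        continuous_foot continuous_conormal_foot smooth_gauge_continuous) auto
  then have "continuous_on (-{0}) (hessian smooth_gauge)"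
    by (rule continuous_on_eq) (simp add: hessian_smooth_gauge)
  then show ?thesis
    unfolding C2_on_def
    using GDERIV_smooth_gauge gradient_has_derivative
    by (auto simp: gderiv_def differentiable_def)
qed

end

section \<open>Subdifferential of the dual norm\<close>

lemma inner_le_dual_norm:
  fixes \<phi> :: "real^'n \<Rightarrow> real"
  assumes "finsler_norm \<phi>"
  shows "p \<bullet> r \<le> dual_norm \<phi> p * \<phi> r"
proof (cases "r = 0")
  case False
  obtain q where "\<And>r. r \<noteq> 0 \<Longrightarrow> (p \<bullet> r) / \<phi> r \<le> dual_norm \<phi> p"
    using dual_norm_attained[OF assms] by metis
  with False show ?thesis using finsler_norm_pos[OF assms False] by (simp add: divide_le_eq)
qed (simp add: finsler_norm_zero[OF assms])

lemma dual_norm_leI: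
  fixes \<phi> :: "real^'n \<Rightarrow> real"
  assumes "finsler_norm \<phi>" and "\<And>r. p \<bullet> r \<le> M * \<phi> r"
  shows "dual_norm \<phi> p \<le> M"
proof -
  obtain q where "q \<noteq> 0" "dual_norm \<phi> p = (p \<bullet> q) / \<phi> q"
    using dual_norm_attained[OF assms(1)] by metis
  then show ?thesis
    using assms(2)[of q] finsler_norm_pos[OF assms(1), of q] by (simp add: divide_le_eq)
qed

text \<open>
  For a sublinear function \<open>g\<close> the subgradients at \<open>N\<close> are exactly the linear minorants of \<open>g\<close> that
  touch it at \<open>N\<close>. Testing the subgradient inequality at \<open>N + p\<close> gives the bound and at \<open>0\<close> the
  contact.
\<close>

lemma subdifferential_dual_norm:
  fixes \<phi> :: "real^'n \<Rightarrow> real"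
  assumes "finsler_norm \<phi>" and y: "y \<in> subdifferential (dual_norm \<phi>) N"
  shows subdifferential_dual_norm_le: "y \<bullet> p \<le> dual_norm \<phi> p"
    and subdifferential_dual_norm_eq: "y \<bullet> N = dual_norm \<phi> N"
proof -
  have sub: "dual_norm \<phi> N + y \<bullet> (p' - N) \<le> dual_norm \<phi> p'" for p'
    using y by (simp add: subdifferential_def)
  have le: "y \<bullet> p \<le> dual_norm \<phi> p" for p
  proof -
    have "dual_norm \<phi> (N + p) \<le> dual_norm \<phi> N + dual_norm \<phi> p"
      using inner_le_dual_norm[OF assms(1)]
      by (intro dual_norm_leI[OF assms(1)]) (simp add: inner_add_left distrib_right add_mono)
    with sub[of "N + p"] show ?thesis by simp
  qed
  then show "y \<bullet> p \<le> dual_norm \<phi> p" .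
  have "dual_norm \<phi> 0 \<le> 0" by (rule dual_norm_leI[OF assms(1)]) simp
  with sub[of 0] le[of N] show "y \<bullet> N = dual_norm \<phi> N" by simp
qed

text \<open>
  The hypothesis on \<open>z\<close> says that \<open>I\<close> lies on a proper face of the dual unit ball. Write \<open>N\<close> for the
  positive combination and \<open>M\<close> for the total weight. Testing against \<open>z\<close> shows that \<open>N\<close>
  has dual norm at least \<open>M\<close>. A subgradient \<open>y\<close> of the dual norm at \<open>N\<close> satisfies \<open>y \<bullet> p \<le> 1\<close> on
  \<open>I\<close>, while the weighted sum of these values, \<open>y \<bullet> N\<close>, is at least \<open>M\<close>; so all are equal to \<open>1\<close>. Hence every \<open>p\<close> in \<open>I\<close>
  differs from \<open>N / M\<close> by a vector orthogonal to all subgradients.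
\<close>

lemma face_subset_shielding_subspace:
  fixes \<phi> :: "real^'n \<Rightarrow> real"
  assumes fin: "finsler_norm \<phi>" and I: "finite I" "p \<in> I"
    and \<mu>: "\<And>p. p \<in> I \<Longrightarrow> 0 < \<mu> p"
    and le: "\<And>p r. p \<in> I \<Longrightarrow> p \<bullet> r \<le> \<phi> r"
    and z: "z \<noteq> 0" "\<And>p. p \<in> I \<Longrightarrow> p \<bullet> z = \<phi> z"
  shows "p \<in> {a + b |a b. a \<in> span {\<Sum>p\<in>I. \<mu> p *\<^sub>R p} \<and> b \<in> tangent_space (\<Sum>p\<in>I. \<mu> p *\<^sub>R p) \<phi>}"
proof -
  define N where "N = (\<Sum>p\<in>I. \<mu> p *\<^sub>R p)"
  define M where "M = (\<Sum>p\<in>I. \<mu> p)"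
  have M: "0 < M" unfolding M_def using I \<mu> by (intro sum_pos) auto
  have "M * \<phi> z = N \<bullet> z" by (simp add: N_def M_def inner_sum_left sum_distrib_right z)
  also have "\<dots> \<le> dual_norm \<phi> N * \<phi> z" by (rule inner_le_dual_norm[OF fin])
  finally have MN: "M \<le> dual_norm \<phi> N" using finsler_norm_pos[OF fin z(1)] by simp
  have "(p - inverse M *\<^sub>R N) \<bullet> y = 0" if y: "y \<in> subdifferential (dual_norm \<phi>) N" for y
  proof -
    have y1: "y \<bullet> p' \<le> 1" if "p' \<in> I" for p'
      using subdifferential_dual_norm_le[OF fin y, of p'] dual_norm_leI[OF fin, of p' 1] le[OF that]
      by simp
    have yN: "y \<bullet> N = (\<Sum>p\<in>I. \<mu> p * (y \<bullet> p))" by (simp add: N_def inner_sum_right)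
    have terms: "0 \<le> \<mu> p' * (1 - y \<bullet> p')" if "p' \<in> I" for p'
      using \<mu>[OF that] y1[OF that] by simp
    have "(\<Sum>p\<in>I. \<mu> p * (1 - y \<bullet> p)) = M - y \<bullet> N"
      by (simp add: M_def yN right_diff_distrib sum_subtractf)
    also have "\<dots> \<le> 0" using MN subdifferential_dual_norm_eq[OF fin y] by simp
    finally have "(\<Sum>p\<in>I. \<mu> p * (1 - y \<bullet> p)) = 0"
      using sum_nonneg[of I "\<lambda>p. \<mu> p * (1 - y \<bullet> p)"] terms by simp
    then have "\<forall>p\<in>I. \<mu> p * (1 - y \<bullet> p) = 0"
      using sum_nonneg_eq_0_iff[OF I(1), of "\<lambda>p. \<mu> p * (1 - y \<bullet> p)"] terms by simp
    then have one: "y \<bullet> p' = 1" if "p' \<in> I" for p' using \<mu>[OF that] that by force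
    have "y \<bullet> N = M" unfolding yN M_def by (intro sum.cong) (auto simp: one)
    then show ?thesis using one[OF I(2)] M by (simp add: inner_diff_left inner_commute[of p y] inner_commute[of N y])
  qed
  then have "p - inverse M *\<^sub>R N \<in> tangent_space N \<phi>" by (simp add: tangent_space_def)
  moreover have "inverse M *\<^sub>R N \<in> span {N}" by (intro span_scale span_base) simp
  moreover have "p = inverse M *\<^sub>R N + (p - inverse M *\<^sub>R N)" by simp
  ultimately show ?thesis unfolding N_def by blast
qed

section \<open>Symmetric matrices supported on a subspace\<close>

lemma
  fixes V :: "(real^'n) set"
  assumes "subspace V"
  shows orth_proj_mem: "orth_proj V x \<in> V"
    and orth_proj_inner: "u \<in> V \<Longrightarrow> orth_proj V x \<bullet> u = x \<bullet> u"
  using theI'[OF orth_proj_unique[OF assms, of x]]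
  unfolding orth_proj_def[symmetric] by (auto simp: inner_diff_left)

lemma orth_proj_eqI:
  fixes V :: "(real^'n) set"
  assumes "subspace V" "y \<in> V" "\<And>u. u \<in> V \<Longrightarrow> y \<bullet> u = x \<bullet> u"
  shows "orth_proj V x = y"
  unfolding orth_proj_def using assms
  by (intro the1_equality[OF orth_proj_unique]) (auto simp: inner_diff_left)

lemma linear_orth_proj:
  fixes V :: "(real^'n) set"
  assumes "subspace V"
  shows "linear (orth_proj V)"
  by (rule linearI; rule orth_proj_eqI[OF assms])
    (use assms in \<open>auto simp: inner_add_left orth_proj_inner orth_proj_mem subspace_add subspace_scale\<close>)

text \<open>
  For a symmetric matrix, having its range in \<open>V\<close> already forces invariance under compression to \<open>V\<close>
  from both sides. Summands of weight zero are exempt since the vectors of inactive constraints need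
  not lie in the subspace.
\<close>

lemma sum_outer_products_in_sym_matrices_on:
  fixes V :: "(real^'n) set"
  assumes V: "subspace V" and u: "\<And>p. p \<in> P \<Longrightarrow> c p \<noteq> 0 \<Longrightarrow> u p \<in> V"
  shows "(\<chi> i j. \<Sum>p\<in>P. c p * u p $ j * u p $ i) \<in> sym_matrices_on V"
proof -
  define X where "X = (\<chi> i j. \<Sum>p\<in>P. c p * u p $ j * u p $ i)"
  let ?\<pi> = "orth_proj V"
  have X: "X *v h = (\<Sum>p\<in>P. (c p * (u p \<bullet> h)) *\<^sub>R u p)" for h
  proof (rule vec_eq_iff[THEN iffD2], rule allI)
    fix i
    have "(X *v h) $ i = (\<Sum>j\<in>UNIV. \<Sum>p\<in>P. c p * u p $ j * u p $ i * h $ j)"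
      by (simp add: X_def matrix_vector_mult_def sum_distrib_right)
    also have "\<dots> = (\<Sum>p\<in>P. \<Sum>j\<in>UNIV. c p * u p $ j * u p $ i * h $ j)" by (rule sum.swap)
    also have "\<dots> = (\<Sum>p\<in>P. (c p * (u p \<bullet> h)) *\<^sub>R u p) $ i"
      by (auto simp: inner_vec_def sum_distrib_left sum_distrib_right algebra_simps intro!: sum.cong)
    finally show "(X *v h) $ i = (\<Sum>p\<in>P. (c p * (u p \<bullet> h)) *\<^sub>R u p) $ i" .
  qed
  have XV: "X *v h \<in> V" for h
    unfolding X
  proof (rule subspace_sum[OF V])
    fix p assume "p \<in> P"
    then show "(c p * (u p \<bullet> h)) *\<^sub>R u p \<in> V"
      using u[of p] subspace_scale[OF V] subspace_0[OF V] by (cases "c p = 0") auto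
  qed
  have X\<pi>: "X *v ?\<pi> h = X *v h" for h
    unfolding X
  proof (intro sum.cong refl arg_cong2[where f = scaleR])
    fix p assume "p \<in> P"
    then show "c p * (u p \<bullet> ?\<pi> h) = c p * (u p \<bullet> h)"
      using u[of p] orth_proj_inner[OF V, of "u p" h] by (cases "c p = 0") (auto simp: inner_commute)
  qed
  have "(matrix ?\<pi> ** X ** matrix ?\<pi>) *v h = X *v h" for h
  proof -
    have "(matrix ?\<pi> ** X ** matrix ?\<pi>) *v h = ?\<pi> (X *v ?\<pi> h)"
      by (simp add: matrix_vector_mul_assoc[symmetric] fun_cong[OF matrix_vector_mul(2)[OF linear_orth_proj[OF V]]])
    also have "\<dots> = ?\<pi> (X *v h)" by (simp only: X\<pi>)
    also have "\<dots> = X *v h" using XV by (intro orth_proj_eqI[OF V]) auto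
    finally show ?thesis .
  qed
  then have "matrix ?\<pi> ** X ** matrix ?\<pi> = X" by (simp add: matrix_eq)
  moreover have "transpose X = X"
    by (simp add: X_def transpose_def vec_eq_iff mult.assoc mult.commute mult.left_commute)
  ultimately show ?thesis unfolding X_def[symmetric] sym_matrices_on_def by simp
qed

section \<open>Shielding norms of polyhedral norms\<close>

text \<open>
  For a subset \<open>J\<close> of \<open>P\<close> that does not lie on a common face, the sum of the gaps \<open>\<phi> x - p \<bullet> x\<close> over
  \<open>J\<close> is positive on the compact unit sphere, hence at least a fixed multiple of \<open>norm x\<close>; but it is
  at most \<open>\<epsilon> * card J\<close> if \<open>\<phi> x \<le> 1 + \<epsilon>\<close> and \<open>p \<bullet> x > 1\<close> on \<open>J\<close>. So \<open>J\<close> cannot be the set of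
  constraints violated at such a point when \<open>\<epsilon>\<close> is small, and \<open>P\<close> has only finitely many subsets.
\<close>

lemma nearly_active_on_common_face:
  fixes \<phi> :: "real^'n \<Rightarrow> real"
  assumes fin: "finsler_norm \<phi>" and P: "finite P" and le: "\<And>p r. p \<in> P \<Longrightarrow> p \<bullet> r \<le> \<phi> r"
  shows "\<exists>\<epsilon>>0. \<forall>x. x \<noteq> 0 \<and> \<phi> x \<le> 1 + \<epsilon> \<longrightarrow> (\<exists>z. z \<noteq> 0 \<and> (\<forall>p\<in>P. 1 < p \<bullet> x \<longrightarrow> p \<bullet> z = \<phi> z))"
proof -
  have single: "\<exists>\<epsilon>>0. \<forall>x. x \<noteq> 0 \<and> \<phi> x \<le> 1 + \<epsilon> \<and> (\<forall>p\<in>J. 1 < p \<bullet> x) \<longrightarrow> (\<exists>z. z \<noteq> 0 \<and> (\<forall>p\<in>J. p \<bullet> z = \<phi> z))"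
    if J: "J \<subseteq> P" "J \<noteq> {}" for J
  proof (cases "\<exists>z. z \<noteq> 0 \<and> (\<forall>p\<in>J. p \<bullet> z = \<phi> z)")
    case True
    then show ?thesis by (intro exI[of _ 1]) auto
  next
    case False
    have finJ: "finite J" using J(1) P by (rule finite_subset)
    let ?gap = "\<lambda>x. \<Sum>p\<in>J. \<phi> x - p \<bullet> x"
    obtain j where j: "j \<in> J" using J(2) by blast
    have "sphere (0::real^'n) 1 \<noteq> {}" by simp
    moreover have "continuous_on (sphere 0 1) ?gap"
      by (intro continuous_intros finsler_norm_continuous[OF fin])
    ultimately obtain w where w: "w \<in> sphere 0 1" and min: "\<forall>y\<in>sphere 0 1. ?gap w \<le> ?gap y"
      using continuous_attains_inf[of "sphere (0::real^'n) 1" ?gap] by auto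
    have nn: "0 \<le> \<phi> x - p \<bullet> x" if "p \<in> J" for x p using le[of p x] that J(1) by auto
    have "w \<noteq> 0" using w by auto
    then obtain p where "p \<in> J" "p \<bullet> w \<noteq> \<phi> w" using False by blast
    then have gw: "0 < ?gap w"
      using nn[of _ w] by (intro sum_pos2[OF finJ, of p]) (auto simp: less_le)
    have gap: "?gap w * norm x \<le> ?gap x" if "x \<noteq> 0" for x
    proof -
      have "?gap w \<le> ?gap (inverse (norm x) *\<^sub>R x)" using that by (intro bspec[OF min]) simp
      also have "\<dots> = inverse (norm x) * ?gap x"
        using fin that by (simp add: finsler_norm_def sum_distrib_left right_diff_distrib)
      finally show ?thesis using that by (simp add: field_simps)
    qed
    have jpos: "0 < norm j + 1" "0 < real (card J)" using j finJ by (auto simp: add_nonneg_pos card_gt_0_iff)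
    \<comment> \<open>the points in question satisfy \<open>norm x > 1 / (norm j + 1)\<close> because \<open>j \<bullet> x > 1\<close>\<close>
    define \<epsilon> where "\<epsilon> = ?gap w / ((norm j + 1) * real (card J))"
    have e: "0 < \<epsilon>" using gw jpos by (simp add: \<epsilon>_def)
    have "\<not> (x \<noteq> 0 \<and> \<phi> x \<le> 1 + \<epsilon> \<and> (\<forall>p\<in>J. 1 < p \<bullet> x))" for x
    proof
      assume x: "x \<noteq> 0 \<and> \<phi> x \<le> 1 + \<epsilon> \<and> (\<forall>p\<in>J. 1 < p \<bullet> x)"
      have "1 < j \<bullet> x" using x j by blast
      also have "\<dots> \<le> norm j * norm x" by (rule norm_cauchy_schwarz)
      also have "\<dots> \<le> (norm j + 1) * norm x" by (intro mult_right_mono) auto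
      finally have "?gap w < ?gap w * ((norm j + 1) * norm x)" using gw by simp
      also have "\<dots> = (norm j + 1) * (?gap w * norm x)" by (simp add: algebra_simps)
      also have "\<dots> \<le> (norm j + 1) * ?gap x" using gap x jpos by (intro mult_left_mono) auto
      also have "?gap x \<le> (\<Sum>p\<in>J. \<epsilon>)" using x by (intro sum_mono) force
      also have "(norm j + 1) * (\<Sum>p\<in>J. \<epsilon>) = ?gap w" using jpos by (simp add: \<epsilon>_def)
      finally show False using jpos by simp
    qed
    with e show ?thesis by blast
  qed
  then obtain E where E: "\<And>J. J \<subseteq> P \<Longrightarrow> J \<noteq> {} \<Longrightarrow> 0 < E J"
      "\<And>J x. J \<subseteq> P \<Longrightarrow> J \<noteq> {} \<Longrightarrow> x \<noteq> 0 \<Longrightarrow> \<phi> x \<le> 1 + E J \<Longrightarrow> \<forall>p\<in>J. 1 < p \<bullet> x \<Longrightarrow>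
         \<exists>z. z \<noteq> 0 \<and> (\<forall>p\<in>J. p \<bullet> z = \<phi> z)"
    by metis
  \<comment> \<open>the entry \<open>1\<close> only keeps the set nonempty when \<open>P\<close> is empty\<close>
  define \<epsilon> where "\<epsilon> = Min (insert 1 (E ` (Pow P - {{}})))"
  have finE: "finite (insert 1 (E ` (Pow P - {{}})))" using P by simp
  have pos: "0 < \<epsilon>" unfolding \<epsilon>_def using finE E(1) by (subst Min_gr_iff) auto
  show ?thesis
  proof (intro exI[of _ \<epsilon>] conjI pos allI impI)
    fix x assume x: "x \<noteq> 0 \<and> \<phi> x \<le> 1 + \<epsilon>"
    define J where "J = {p\<in>P. 1 < p \<bullet> x}"
    show "\<exists>z. z \<noteq> 0 \<and> (\<forall>p\<in>P. 1 < p \<bullet> x \<longrightarrow> p \<bullet> z = \<phi> z)"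
    proof (cases "J = {}")
      case True
      then show ?thesis using x by (intro exI[of _ x]) (auto simp: J_def)
    next
      case False
      have "J \<subseteq> P" by (auto simp: J_def)
      then have "\<epsilon> \<le> E J" unfolding \<epsilon>_def using False finE by (intro Min_le) auto
      then have "\<phi> x \<le> 1 + E J" using x by linarith
      moreover have "\<forall>p\<in>J. 1 < p \<bullet> x" by (simp add: J_def)
      ultimately obtain z where "z \<noteq> 0" "\<forall>p\<in>J. p \<bullet> z = \<phi> z"
        using E(2)[of J x] False \<open>J \<subseteq> P\<close> x by blast
      then show ?thesis by (auto simp: J_def)
    qed
  qed
qed

lemma subspace_shielding:
  fixes \<phi> :: "real^'n \<Rightarrow> real"
  shows "subspace {a + b |a b. a \<in> span {N} \<and> b \<in> tangent_space N \<phi>}"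
proof -
  have "subspace (tangent_space N \<phi>)"
    by (auto simp: subspace_def tangent_space_def inner_add_left)
  then show ?thesis using subspace_sums[OF subspace_span] by blast
qed

text \<open>
  The weight of \<open>p\<close> in the Hessian and its coefficient in the conormal \<open>N\<close> are nonzero for the same
  \<open>p\<close>, namely those with \<open>p \<bullet> foot q > 1\<close>. By \<open>face_subset_shielding_subspace\<close> these \<open>p\<close> lie in the
  shielding subspace of \<open>N\<close>, and so do the vectors \<open>hessian_vec q p\<close>.
\<close>

lemma (in smoothed_polytope) shielding_norm_smooth_gauge:
  assumes fin: "finsler_norm \<phi>" and le: "\<And>p r. p \<in> P \<Longrightarrow> p \<bullet> r \<le> \<phi> r"
    and face: "\<And>x. penalty x = \<epsilon> ^ 3 \<Longrightarrow> \<exists>z. z \<noteq> 0 \<and> (\<forall>p\<in>P. 1 < p \<bullet> x \<longrightarrow> p \<bullet> z = \<phi> z)"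
  shows "shielding_norm \<phi> smooth_gauge"
proof -
  have "hessian smooth_gauge q \<in> shielding_space (gradient smooth_gauge q) \<phi>" if q: "q \<noteq> 0" for q
  proof -
    define x where "x = foot q"
    define N where "N = conormal x"
    define V where "V = {a + b |a b. a \<in> span {N} \<and> b \<in> tangent_space N \<phi>}"
    define I where "I = {p\<in>P. 1 < p \<bullet> x}"
    define \<mu> where "\<mu> p = 3 * (excess p x)\<^sup>2 / (penalty_grad x \<bullet> x)" for p
    have level: "penalty x = \<epsilon> ^ 3" using penalty_foot[OF q] by (simp add: x_def)
    obtain z where z: "z \<noteq> 0" "\<forall>p\<in>P. 1 < p \<bullet> x \<longrightarrow> p \<bullet> z = \<phi> z" using face[OF level] by blast
    have V: "subspace V" unfolding V_def by (rule subspace_shielding)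
    have "N = (\<Sum>p\<in>P. \<mu> p *\<^sub>R p)"
      by (simp add: N_def conormal_def \<mu>_def scaleR_sum_right divide_inverse mult.commute
          penalty_grad_def[of x])
    also have "\<dots> = (\<Sum>p\<in>I. \<mu> p *\<^sub>R p)"
      using finite_P by (intro sum.mono_neutral_right) (auto simp: I_def \<mu>_def excess_def)
    finally have N: "N = (\<Sum>p\<in>I. \<mu> p *\<^sub>R p)" .
    have IV: "p \<in> V" if "p \<in> I" for p
      unfolding V_def N
      by (rule face_subset_shielding_subspace[OF fin, where z = z])
        (use that z le finite_P penalty_grad_inner_pos[OF level] in \<open>auto simp: I_def \<mu>_def excess_def\<close>)
    have "0 \<in> tangent_space N \<phi>" by (simp add: tangent_space_def)
    then have NV: "N \<in> V" unfolding V_def by (force intro: span_base)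
    have "hessian_vec q p \<in> V" if "p \<in> P" "hessian_weight q p \<noteq> 0" for p
    proof -
      have "p \<in> I" using that by (auto simp: I_def hessian_weight_def excess_def x_def max_def split: if_splits)
      then show ?thesis
        unfolding hessian_vec_def x_def[symmetric] N_def[symmetric]
        by (intro subspace_diff[OF V] subspace_scale[OF V] IV NV)
    qed
    then show ?thesis
      using sum_outer_products_in_sym_matrices_on[OF V, of P "hessian_weight q" "hessian_vec q"]
      by (simp add: hessian_smooth_gauge[OF q] gradient_smooth_gauge[OF q] shielding_space_def
          V_def N_def x_def)
  qed
  then show ?thesis
    unfolding shielding_norm_def using finsler_norm_smooth_gauge C2_smooth_gauge by blast
qed

theorem theorem2:
  fixes \<phi> :: "real^'n \<Rightarrow> real"
  assumes "finsler_norm \<phi>" and "polyhedral \<phi>"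
  shows "(\<exists>\<psi>. shielding_norm \<phi> \<psi>) \<and>
    (\<forall>\<delta>>0. \<exists>\<psi>. shielding_norm \<phi> \<psi> \<and> (SUP e\<in>sphere 0 1. \<bar>\<psi> e - \<phi> e\<bar>) \<le> \<delta>)"
proof -
  note fin = assms(1)
  obtain P where P: "finite P" "P \<noteq> {}" and \<phi>: "\<And>q. \<phi> q = Max ((\<lambda>p. p \<bullet> q) ` P)"
    using assms(2) unfolding polyhedral_def by blast
  have le: "p \<bullet> r \<le> \<phi> r" if "p \<in> P" for p r
    unfolding \<phi> using P that by (intro Max_ge) auto
  have att: "\<exists>p\<in>P. p \<bullet> q = \<phi> q" for q
  proof -
    have "\<phi> q \<in> (\<lambda>p. p \<bullet> q) ` P" unfolding \<phi> using P by (intro Max_in) auto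
    then show ?thesis by auto
  qed
  obtain \<epsilon>0 where e0: "0 < \<epsilon>0"
    "\<And>x. x \<noteq> 0 \<Longrightarrow> \<phi> x \<le> 1 + \<epsilon>0 \<Longrightarrow> \<exists>z. z \<noteq> 0 \<and> (\<forall>p\<in>P. 1 < p \<bullet> x \<longrightarrow> p \<bullet> z = \<phi> z)"
    using nearly_active_on_common_face[OF fin P(1) le] by blast
  obtain C where C: "\<And>e. e \<in> sphere 0 1 \<Longrightarrow> \<phi> e \<le> C"
  proof -
    have "compact (\<phi> ` sphere 0 1)"
      by (intro compact_continuous_image finsler_norm_continuous[OF fin]) simp
    then have "bdd_above (\<phi> ` sphere 0 1)" by (intro bounded_imp_bdd_above compact_imp_bounded)
    then obtain M where "\<forall>y\<in>\<phi> ` sphere 0 1. y \<le> M" by (auto simp: bdd_above_def)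
    then show ?thesis by (intro that[of M]) blast
  qed
  have close: "\<exists>\<psi>. shielding_norm \<phi> \<psi> \<and> (SUP e\<in>sphere 0 1. \<bar>\<psi> e - \<phi> e\<bar>) \<le> \<delta>" if "0 < \<delta>" for \<delta>
  proof -
    \<comment> \<open>on the unit sphere the error is at most \<open>\<epsilon>\<close> times the gauge, and the gauge is at most \<open>C\<close>\<close>
    define \<epsilon> where "\<epsilon> = min \<epsilon>0 (\<delta> / (\<bar>C\<bar> + 1))"
    have e: "0 < \<epsilon>" "\<epsilon> \<le> \<epsilon>0" "\<epsilon> \<le> \<delta> / (\<bar>C\<bar> + 1)" using e0(1) that by (auto simp: \<epsilon>_def)
    interpret smoothed_polytope P \<epsilon>
    proof
      fix q :: "real^'n" assume "q \<noteq> 0"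
      then show "\<exists>p\<in>P. 0 < p \<bullet> q" using att[of q] finsler_norm_pos[OF fin, of q] by metis
    qed (use P e in auto)
    have upper: "\<phi> x \<le> 1 + \<epsilon>" and lower: "1 < \<phi> x" if level: "penalty x = \<epsilon> ^ 3" for x
    proof -
      show "\<phi> x \<le> 1 + \<epsilon>" using att[of x] inner_le_on_level[OF level] by metis
      show "1 < \<phi> x" using exists_active[OF level] le by (meson less_le_trans)
    qed
    have sh: "shielding_norm \<phi> smooth_gauge"
    proof (rule shielding_norm_smooth_gauge[OF fin le])
      fix x assume level: "penalty x = \<epsilon> ^ 3"
      have "x \<noteq> 0" using lower[OF level] finsler_norm_zero[OF fin] by auto
      then show "\<exists>z. z \<noteq> 0 \<and> (\<forall>p\<in>P. 1 < p \<bullet> x \<longrightarrow> p \<bullet> z = \<phi> z)"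
        using e0(2)[of x] upper[OF level] e(2) by simp
    qed
    have "\<bar>smooth_gauge e - \<phi> e\<bar> \<le> \<delta>" if es: "e \<in> sphere 0 1" for e
    proof -
      have nz: "e \<noteq> 0" using es by auto
      note g = smooth_gauge_pos[OF nz]
      have "\<phi> e = smooth_gauge e * \<phi> (foot e)"
        using fin g smooth_gauge_scale_foot[OF nz] by (metis finsler_norm_def)
      then have lo: "smooth_gauge e \<le> \<phi> e" and hi: "\<phi> e \<le> smooth_gauge e * (1 + \<epsilon>)"
        using upper[OF penalty_foot[OF nz]] lower[OF penalty_foot[OF nz]] g by auto
      have "\<phi> e - smooth_gauge e \<le> \<epsilon> * smooth_gauge e" using hi by (simp add: algebra_simps)
      also have "\<dots> \<le> \<delta> / (\<bar>C\<bar> + 1) * (\<bar>C\<bar> + 1)"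
        using e lo C[OF es] g by (intro mult_mono) auto
      also have "\<dots> = \<delta>" by (simp add: add_nonneg_eq_0_iff)
      finally show ?thesis using lo by simp
    qed
    then show ?thesis
      using sh uniform_distance_le_iff[OF fin finsler_norm_smooth_gauge] by blast
  qed
  from close[of 1] have "\<exists>\<psi>. shielding_norm \<phi> \<psi>" by auto
  with close show ?thesis by blast
qed

end
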